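(* For any $n \geq 0$, each equivalence class of $\mathfrak{S}_n/_{\equiv_{\mathrm{B}}}$ is an interval of the permutohedron, that is, an interval of the poset $(\mathfrak{S}_n, \leq_{\mathrm{P}})$.
   Context: $A = \{a_1 < a_2 < \cdots\}$ is a totally ordered infinite alphabet and $A^*$ is the free monoid of words on $A$. A congruence on $A^*$ is an equivalence relation compatible with concatenation. The Baxter congruence $\equiv_{\mathrm{B}}$ is the smallest congruence on $A^*$ such that, for all words $u, v \in A^*$ and letters $a,b,c,d \in A$: $\; c\,u\,a d\,v\,b \equiv_{\mathrm{B}} c\,u\,d a\,v\,b$ whenever $a \leq b < c \leq d$, and $\; b\,u\,d a\,v\,c \equiv_{\mathrm{B}} b\,u\,a d\,v\,c$ whenever $a < b \leq c < d$. $\mathfrak{S}_n$ is the set of permutations of size $n$, a permutation of size $n$ being seen as a word of length $n$ without repetition on the first $n$ letters of $A$ (identified with $1,\dots,n$); $\equiv_{\mathrm{B}}$ thus restricts to an equivalence relation on $\mathfrak{S}_n$. The (right) permutohedron order $\leq_{\mathrm{P}}$ is the partial order on $\mathfrak{S}_n$ in which $\sigma$ is covered by $\nu$ if and only if $\sigma = u\,a b\,v$ and $\nu = u\,b a\,v$ for some words $u, v$ and letters $a < b$. It is a lattice. *)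

theory Defs
  imports Main "HOL-Combinatorics.Multiset_Permutations"
begin

text \<open>
  The alphabet \<open>a\<^sub>1 < a\<^sub>2 < \<dots>\<close> is represented by the type \<^typ>\<open>nat\<close> with its usual
  order, the letter \<open>a\<^sub>i\<close> being \<open>i - 1\<close>. So the first \<open>n\<close> letters are the
  elements of \<^term>\<open>{..<n::nat}\<close>, and words are lists of natural numbers.
\<close>

type_synonym letter = nat
type_synonym word = "letter list"

text \<open>
  The last four rules close the two adjacency relations under the axioms of a congruence of
  the free monoid, so the least relation satisfying all the rules is the least congruence
  containing them.
\<close>

inductive baxter_cong :: "word \<Rightarrow> word \<Rightarrow> bool" (infix "\<equiv>\<^sub>B" 50) where
  adj1: "a \<le> b \<Longrightarrow> b < c \<Longrightarrow> c \<le> d \<Longrightarrow>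
    [c] @ u @ [a, d] @ v @ [b] \<equiv>\<^sub>B [c] @ u @ [d, a] @ v @ [b]"
| adj2: "a < b \<Longrightarrow> b \<le> c \<Longrightarrow> c < d \<Longrightarrow>
    [b] @ u @ [d, a] @ v @ [c] \<equiv>\<^sub>B [b] @ u @ [a, d] @ v @ [c]"
| refl: "w \<equiv>\<^sub>B w"
| sym: "w \<equiv>\<^sub>B w' \<Longrightarrow> w' \<equiv>\<^sub>B w"
| trans: "w \<equiv>\<^sub>B w' \<Longrightarrow> w' \<equiv>\<^sub>B w'' \<Longrightarrow> w \<equiv>\<^sub>B w''"
| append: "w \<equiv>\<^sub>B w' \<Longrightarrow> z \<equiv>\<^sub>B z' \<Longrightarrow> w @ z \<equiv>\<^sub>B w' @ z'"

definition perms :: "nat \<Rightarrow> word set" where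
  "perms n = permutations_of_set {..<n}"

definition baxter_on_perms :: "nat \<Rightarrow> word rel" where
  "baxter_on_perms n = {(\<sigma>, \<nu>). \<sigma> \<in> perms n \<and> \<nu> \<in> perms n \<and> \<sigma> \<equiv>\<^sub>B \<nu>}"

definition permutohedron_cover :: "nat \<Rightarrow> word rel" where
  "permutohedron_cover n = {(\<sigma>, \<nu>). \<sigma> \<in> perms n \<and> \<nu> \<in> perms n \<and>
     (\<exists>u v a b. a < b \<and> \<sigma> = u @ [a, b] @ v \<and> \<nu> = u @ [b, a] @ v)}"

text \<open>
  A finite partial order is the reflexive transitive closure of its covering relation. The
  intersection discards the reflexive pairs of words that are not permutations of size \<open>n\<close>.
\<close>

definition permutohedron :: "nat \<Rightarrow> word rel" where
  "permutohedron n = (permutohedron_cover n)\<^sup>* \<inter> (perms n \<times> perms n)"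

definition poset_interval :: "'a set \<Rightarrow> 'a rel \<Rightarrow> 'a set \<Rightarrow> bool" where
  "poset_interval P r I \<longleftrightarrow>
     (\<exists>x\<in>P. \<exists>y\<in>P. (x, y) \<in> r \<and> I = {z \<in> P. (x, z) \<in> r \<and> (z, y) \<in> r})"

end

theory Submission
  imports Defs
begin

text \<open>
  Call a pair \<open>(p, q)\<close> with \<open>p\<close> to the left of \<open>q\<close> in a permutation forced if no letter
  strictly between them in value is to the left of \<open>p\<close>, or none is to the right of \<open>q\<close>. The
  Baxter moves on permutations are exactly the exchanges of adjacent letters that are not
  forced, and they do not change the forced pairs. Hence the class of \<open>\<sigma>\<close> consists of the
  linear extensions of its forced relation: as long as \<open>\<sigma>\<close> differs from such an extension
  \<open>\<tau>\<close>, some adjacent pair of \<open>\<sigma>\<close> is reversed in \<open>\<tau>\<close>, and so can be exchanged. The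
  permutohedron is the inclusion order of inversion sets, so classes are convex. Finally, in a
  class member with fewest inversions all adjacent descents are forced, and then every inversion
  is a consequence of forced pairs and is shared by the whole class. So this member is the least
  one, and dually the member with most inversions is the greatest.
\<close>

section \<open>Order of occurrence of letters in a word\<close>

fun precedes :: "'a list \<Rightarrow> 'a \<Rightarrow> 'a \<Rightarrow> bool" where
  "precedes [] x y = False"
| "precedes (a # w) x y = (x = a \<and> y \<in> set w \<or> precedes w x y)"

lemma precedes_append [simp]:
  "precedes (u @ v) x y \<longleftrightarrow> precedes u x y \<or> precedes v x y \<or> x \<in> set u \<and> y \<in> set v"
  by (induction u) auto

lemma precedes_set: "precedes w x y \<Longrightarrow> x \<in> set w \<and> y \<in> set w"
  by (induction w) auto

lemma precedes_irrefl: "distinct w \<Longrightarrow> \<not> precedes w x x"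
  by (induction w) auto

lemma precedes_trans: "distinct w \<Longrightarrow> precedes w x y \<Longrightarrow> precedes w y z \<Longrightarrow> precedes w x z"
  by (induction w) (auto dest: precedes_set)

lemma precedes_asym: "distinct w \<Longrightarrow> precedes w x y \<Longrightarrow> \<not> precedes w y x"
  using precedes_irrefl precedes_trans by metis

lemma precedes_total:
  "x \<in> set w \<Longrightarrow> y \<in> set w \<Longrightarrow> x \<noteq> y \<Longrightarrow> precedes w x y \<or> precedes w y x"
  by (induction w) auto

lemma precedes_split: "precedes w x y \<Longrightarrow> \<exists>u m v. w = u @ [x] @ m @ [y] @ v"
proof (induction w)
  case (Cons a w)
  show ?case
  proof (cases "x = a \<and> y \<in> set w")
    case True
    then obtain m v where "w = m @ [y] @ v" by (metis append_Cons append_Nil split_list)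
    then have "a # w = [] @ [x] @ m @ [y] @ v" using True by simp
    then show ?thesis by blast
  next
    case False
    then obtain u m v where "w = u @ [x] @ m @ [y] @ v" using Cons by auto
    then have "a # w = (a # u) @ [x] @ m @ [y] @ v" by simp
    then show ?thesis by blast
  qed
qed simp

lemma precedes_swap:
  "distinct (u @ [p, q] @ v) \<Longrightarrow>
    precedes (u @ [q, p] @ v) x y \<longleftrightarrow>
      x = q \<and> y = p \<or> precedes (u @ [p, q] @ v) x y \<and> \<not> (x = p \<and> y = q)"
  by (auto dest: precedes_set)

text \<open>A total strict order is not properly contained in another one on the same set, and a
  word without repetition is determined by its order of occurrence.\<close>

lemma precedes_subset_imp_eq:
  assumes "distinct s" "distinct t" "set s = set t" "\<And>x y. precedes s x y \<Longrightarrow> precedes t x y"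
  shows "s = t"
  using assms
proof (induction s arbitrary: t)
  case (Cons a s)
  then obtain b t' where t: "t = b # t'" by (cases t) auto
  have ab: "a = b"
  proof (rule ccontr)
    assume "a \<noteq> b"
    then have "b \<in> set s" using Cons.prems t by (metis list.set_intros(1) set_ConsD)
    then have "precedes (a # s) a b" by simp
    then have "precedes t a b" using Cons.prems by blast
    then show False using t \<open>a \<noteq> b\<close> Cons.prems by (auto dest: precedes_set)
  qed
  have "s = t'"
  proof (rule Cons.IH)
    fix x y
    assume xy: "precedes s x y"
    then have "precedes t x y" using Cons.prems by auto
    then show "precedes t' x y" using t ab Cons.prems xy by (auto dest: precedes_set)
  next
    show "set s = set t'" using Cons.prems(1-3) t ab by (simp add: insert_ident)
  qed (use Cons.prems t in auto)
  then show ?case using t ab by simp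
qed simp

section \<open>Sorting one word towards another by adjacent exchanges\<close>

lemma successively_adjacent:
  "(\<And>u p q v. w = u @ [p, q] @ v \<Longrightarrow> P p q) \<Longrightarrow> successively P w"
proof (induction w rule: induct_list012)
  case (3 x y zs)
  have "P x y" using "3.prems"[of "[]"] by simp
  moreover have "successively P (y # zs)"
  proof (rule "3.IH")
    fix u p q v assume "y # zs = u @ [p, q] @ v"
    then show "P p q" using "3.prems"[of "x # u"] by simp
  qed
  ultimately show ?case by simp
qed auto

lemma precedes_sorted_wrt: "sorted_wrt R w \<Longrightarrow> precedes w x y \<Longrightarrow> R x y"
  by (induction w) auto

text \<open>If all adjacent pairs of \<open>s\<close> kept their order in \<open>t\<close>,
  transitivity would make \<open>s\<close> sorted by \<open>precedes t\<close>, whence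
  \<open>s = t\<close>.\<close>

lemma adjacent_disagreement:
  assumes "distinct s" "distinct t" "set s = set t" "s \<noteq> t"
  shows "\<exists>u p q v. s = u @ [p, q] @ v \<and> precedes t q p"
proof (rule ccontr)
  assume neg: "\<not> ?thesis"
  have "successively (precedes t) s"
  proof (rule successively_adjacent)
    fix u p q v assume s: "s = u @ [p, q] @ v"
    then have "p \<in> set t" "q \<in> set t" "p \<noteq> q" using assms by (auto simp flip: assms(3))
    then show "precedes t p q" using neg s precedes_total by metis
  qed
  moreover have "transp (precedes t)"
    using precedes_trans[OF assms(2)] by (auto intro: transpI)
  ultimately have "sorted_wrt (precedes t) s"
    by (simp add: successively_conv_sorted_wrt)
  then show False using precedes_subset_imp_eq assms precedes_sorted_wrt by metis
qed

text \<open>Bubble sort: exchanging an adjacent pair that \<open>t\<close> reverses removes one pair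
  from the disagreements with \<open>t\<close> and adds none. The rule serves both the congruence
  and the permutohedron order.\<close>

lemma swap_toward_induct [consumes 3, case_names target swap]:
  assumes "distinct s" "distinct t" "set s = set t"
    and target: "P t"
    and swap: "\<And>u p q v. distinct (u @ [p, q] @ v) \<Longrightarrow> set (u @ [p, q] @ v) = set t \<Longrightarrow>
      precedes t q p \<Longrightarrow> P (u @ [q, p] @ v) \<Longrightarrow> P (u @ [p, q] @ v)"
  shows "P s"
  using assms(1-3)
proof (induction "card {(x, y). precedes s x y \<and> \<not> precedes t x y}"
    arbitrary: s rule: less_induct)
  case less
  show ?case
  proof (cases "s = t")
    case True
    then show ?thesis using target by simp
  next
    case False
    then obtain u p q v where s: "s = u @ [p, q] @ v" and qp: "precedes t q p"
      using adjacent_disagreement less.prems by blast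
    let ?s = "u @ [q, p] @ v"
    let ?D = "\<lambda>s. {(x, y). precedes s x y \<and> \<not> precedes t x y}"
    have d: "distinct (u @ [p, q] @ v)" using less.prems s by blast
    have "finite (?D s)"
      by (rule finite_subset[of _ "set s \<times> set s"]) (auto dest: precedes_set)
    moreover have "?D ?s \<subseteq> ?D s"
      using qp s precedes_swap[OF d] by (auto simp del: precedes_append)
    moreover have "(p, q) \<in> ?D s - ?D ?s"
      using precedes_swap[OF d] qp s precedes_asym[OF less.prems(2)] d by auto
    ultimately have "card (?D ?s) < card (?D s)" by (intro psubset_card_mono) blast+
    moreover have "distinct ?s" "set ?s = set t" using less.prems s by auto
    ultimately have "P ?s" using less.hyps assms(2) by blast
    then show ?thesis using swap d qp s less.prems by blast
  qed
qed

section \<open>Forced pairs and their invariance under exchanges\<close>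

text \<open>Symmetric in \<open>p\<close> and \<open>q\<close>, so that both directions of an
  exchange are treated alike.\<close>

definition between :: "'a::linorder \<Rightarrow> 'a \<Rightarrow> 'a \<Rightarrow> bool" where
  "between p x q \<longleftrightarrow> p < x \<and> x < q \<or> q < x \<and> x < p"

definition forced :: "'a::linorder list \<Rightarrow> 'a \<Rightarrow> 'a \<Rightarrow> bool" where
  "forced w p q \<longleftrightarrow> precedes w p q \<and>
     ((\<forall>x. between p x q \<longrightarrow> \<not> precedes w x p) \<or> (\<forall>y. between p y q \<longrightarrow> \<not> precedes w q y))"

lemma forced_precedes: "forced w p q \<Longrightarrow> precedes w p q"
  by (simp add: forced_def)

text \<open>Only the order of \<open>p\<close> and \<open>q\<close> changes, so only a condition on
  a pair starting with \<open>p\<close> or ending with \<open>q\<close> could break. In that case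
  \<open>x\<close> or \<open>y\<close> would have broken it before the exchange.\<close>

lemma forced_swap_imp:
  assumes d: "distinct (u @ [p, q] @ v)"
    and x: "x \<in> set u" "between p x q" and y: "y \<in> set v" "between p y q"
    and f: "forced (u @ [p, q] @ v) r s"
  shows "forced (u @ [q, p] @ v) r s"
proof -
  let ?w = "u @ [p, q] @ v" and ?w' = "u @ [q, p] @ v"
  note sw = precedes_swap[OF d]
  have xp: "precedes ?w x p" "precedes ?w x q" "precedes ?w p y" "precedes ?w q y"
    using x y by auto
  have rs: "precedes ?w r s" using f forced_precedes by blast
  \<comment> \<open>The letters \<open>x\<close> and \<open>y\<close> refute both alternatives for
    \<open>(p, q)\<close>, so the pair undone by the exchange was not forced.\<close>
  have "\<not> (r = p \<and> s = q)" using f x y xp by (auto simp: forced_def)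
  then have rs': "precedes ?w' r s" using sw rs by blast
  show ?thesis
  proof (cases "\<forall>z. between r z s \<longrightarrow> \<not> precedes ?w z r")
    case True
    have "\<not> precedes ?w' z r" if z: "between r z s" for z
    proof
      assume "precedes ?w' z r"
      then have "z = q" "r = p" using sw True z by blast+
      \<comment> \<open>Since \<open>q\<close> lies between \<open>p\<close> and \<open>s\<close>,
        so does every value between \<open>p\<close> and \<open>q\<close>.\<close>
      then have "between r x s" using z x(2) by (auto simp: between_def)
      then show False using True xp \<open>r = p\<close> by blast
    qed
    then show ?thesis using rs' unfolding forced_def by blast
  next
    case False
    then have R: "\<forall>z. between r z s \<longrightarrow> \<not> precedes ?w s z" using f unfolding forced_def by blast
    have "\<not> precedes ?w' s z" if z: "between r z s" for z
    proof
      assume "precedes ?w' s z"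
      then have "s = q" "z = p" using sw R z by blast+
      then have "between r y s" using z y(2) by (auto simp: between_def)
      then show False using R xp \<open>s = q\<close> by blast
    qed
    then show ?thesis using rs' unfolding forced_def by blast
  qed
qed

lemma forced_swap:
  assumes "distinct (u @ [p, q] @ v)"
    and "x \<in> set u" "between p x q" "y \<in> set v" "between p y q"
  shows "forced (u @ [q, p] @ v) = forced (u @ [p, q] @ v)"
proof (intro ext iffI)
  have "distinct (u @ [q, p] @ v)" "between q x p" "between q y p"
    using assms by (auto simp: between_def)
  then show "forced (u @ [p, q] @ v) r s" if "forced (u @ [q, p] @ v) r s" for r s
    using forced_swap_imp[of u q p v x y r s] that assms(2,4) by simp
qed (rule forced_swap_imp[OF assms])

section \<open>Baxter classes as linear extensions of the forced relation\<close>

lemma baxter_cong_mset: "w \<equiv>\<^sub>B w' \<Longrightarrow> mset w = mset w'"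
  by (induction rule: baxter_cong.induct) auto

lemma baxter_cong_distinct: "w \<equiv>\<^sub>B w' \<Longrightarrow> distinct w \<longleftrightarrow> distinct w'"
  using baxter_cong_mset mset_eq_imp_distinct_iff by blast

lemma baxter_cong_set: "w \<equiv>\<^sub>B w' \<Longrightarrow> set w = set w'"
  using baxter_cong_mset mset_eq_setD by blast

text \<open>Being forced depends on the whole word, so the induction carries an arbitrary context:
  in the \<open>append\<close> case one factor is replaced while the other belongs to the
  context.\<close>

lemma baxter_cong_forced_context:
  "w \<equiv>\<^sub>B w' \<Longrightarrow> distinct (s @ w @ t) \<Longrightarrow> forced (s @ w @ t) = forced (s @ w' @ t)"
proof (induction arbitrary: s t rule: baxter_cong.induct)
  case (adj1 a b c d u v)
  have "forced ((s @ [c] @ u) @ [d, a] @ (v @ [b] @ t)) =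
    forced ((s @ [c] @ u) @ [a, d] @ (v @ [b] @ t))"
    by (rule forced_swap[where x = c and y = b]) (use adj1 in \<open>auto simp: between_def\<close>)
  then show ?case by simp
next
  case (adj2 a b c d u v)
  have "forced ((s @ [b] @ u) @ [a, d] @ (v @ [c] @ t)) =
    forced ((s @ [b] @ u) @ [d, a] @ (v @ [c] @ t))"
    by (rule forced_swap[where x = b and y = c]) (use adj2 in \<open>auto simp: between_def\<close>)
  then show ?case by simp
next
  case (sym w w')
  have "distinct (s @ w @ t)"
    using sym baxter_cong_distinct[OF sym.hyps] baxter_cong_set[OF sym.hyps] by auto
  then show ?case using sym.IH by simp
next
  case (trans w w' w'')
  have "distinct (s @ w' @ t)"
    using trans.prems baxter_cong_distinct[OF trans.hyps(1)] baxter_cong_set[OF trans.hyps(1)]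
    by auto
  then show ?case using trans.IH trans.prems by metis
next
  case (append w w' z z')
  have "distinct ((s @ w') @ z @ t)"
    using append.prems baxter_cong_distinct[OF append.hyps(1)]
      baxter_cong_set[OF append.hyps(1)] by auto
  then have "forced ((s @ w') @ z @ t) = forced ((s @ w') @ z' @ t)" using append.IH by blast
  moreover have "forced (s @ w @ (z @ t)) = forced (s @ w' @ (z @ t))"
    using append.IH append.prems by simp
  ultimately show ?case by simp
qed simp

lemma baxter_cong_forced: "w \<equiv>\<^sub>B w' \<Longrightarrow> distinct w \<Longrightarrow> forced w = forced w'"
  using baxter_cong_forced_context[of w w' "[]" "[]"] by simp

lemma baxter_cong_context: "w \<equiv>\<^sub>B w' \<Longrightarrow> s @ w @ t \<equiv>\<^sub>B s @ w' @ t"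
  by (intro baxter_cong.append baxter_cong.refl)

text \<open>For strictly intermediate outer letters the two rules cover all cases:
  \<open>adj1\<close> has the larger one on the left, \<open>adj2\<close> the smaller or an equal
  one.\<close>

lemma baxter_cong_swap_less:
  assumes "x \<in> set u" "y \<in> set v" "p < x" "x < q" "p < y" "y < q"
  shows "u @ [p, q] @ v \<equiv>\<^sub>B u @ [q, p] @ v"
proof -
  obtain u1 u2 v1 v2 where uv: "u = u1 @ x # u2" "v = v1 @ y # v2"
    using assms by (meson split_list)
  have "[x] @ u2 @ [p, q] @ v1 @ [y] \<equiv>\<^sub>B [x] @ u2 @ [q, p] @ v1 @ [y]"
  proof (cases "x \<le> y")
    case True
    then show ?thesis using assms by (intro baxter_cong.sym[OF baxter_cong.adj2]) auto
  next
    case False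
    then show ?thesis using assms by (intro baxter_cong.adj1) auto
  qed
  from baxter_cong_context[OF this, of u1 v2] show ?thesis using uv by simp
qed

lemma baxter_cong_swap:
  assumes "x \<in> set u" "y \<in> set v" "between p x q" "between p y q"
  shows "u @ [p, q] @ v \<equiv>\<^sub>B u @ [q, p] @ v"
  using assms baxter_cong_swap_less[of x u y v p q]
    baxter_cong.sym[OF baxter_cong_swap_less[of x u y v q p]]
  by (auto simp: between_def)

lemma baxter_cong_swap_not_forced:
  assumes "distinct (u @ [p, q] @ v)" "\<not> forced (u @ [p, q] @ v) p q"
  shows "u @ [p, q] @ v \<equiv>\<^sub>B u @ [q, p] @ v"
proof -
  have "precedes (u @ [p, q] @ v) p q" by simp
  then obtain x y where x: "between p x q" "precedes (u @ [p, q] @ v) x p"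
    and y: "between p y q" "precedes (u @ [p, q] @ v) q y"
    using assms(2) unfolding forced_def by blast
  have "x \<in> set u" "y \<in> set v" using assms(1) x y by (auto dest: precedes_set)
  then show ?thesis using baxter_cong_swap x y by blast
qed

text \<open>Sorting \<open>s\<close> towards \<open>t\<close> exchanges only pairs reversed in
  \<open>t\<close>, which are therefore not forced. Each exchange is a Baxter move and keeps the
  forced pairs, so the hypothesis survives.\<close>

lemma baxter_cong_iff_forced:
  assumes "distinct s" "distinct t" "set s = set t"
  shows "s \<equiv>\<^sub>B t \<longleftrightarrow> (\<forall>p q. forced s p q \<longrightarrow> precedes t p q)"
proof
  assume "s \<equiv>\<^sub>B t"
  then show "\<forall>p q. forced s p q \<longrightarrow> precedes t p q"
    using baxter_cong_forced assms forced_precedes by metis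
next
  assume "\<forall>p q. forced s p q \<longrightarrow> precedes t p q"
  with assms show "s \<equiv>\<^sub>B t"
  proof (induction rule: swap_toward_induct)
    case target
    show ?case by (rule baxter_cong.refl)
  next
    case (swap u p q v)
    have "\<not> forced (u @ [p, q] @ v) p q"
      using swap precedes_asym[OF assms(2)] by blast
    then have c: "u @ [p, q] @ v \<equiv>\<^sub>B u @ [q, p] @ v"
      using baxter_cong_swap_not_forced swap by blast
    then have "forced (u @ [q, p] @ v) = forced (u @ [p, q] @ v)"
      using baxter_cong_forced swap by metis
    then show ?case using c swap baxter_cong.trans by metis
  qed
qed

section \<open>The permutohedron order as inclusion of inversion sets\<close>

lemma perms_iff: "w \<in> perms n \<longleftrightarrow> distinct w \<and> set w = {..<n}"
  by (auto simp: perms_def permutations_of_set_def)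

text \<open>A cover adds one inversion and destroys none. Conversely, if \<open>t\<close> has all
  inversions of \<open>s\<close>, sorting \<open>s\<close> towards \<open>t\<close> exchanges only
  ascents and so climbs along covers.\<close>

lemma permutohedron_iff:
  "(s, t) \<in> permutohedron n \<longleftrightarrow> s \<in> perms n \<and> t \<in> perms n \<and>
     (\<forall>a b. a < b \<longrightarrow> precedes s b a \<longrightarrow> precedes t b a)"
proof (intro iffI conjI)
  assume "(s, t) \<in> permutohedron n"
  then have st: "(s, t) \<in> (permutohedron_cover n)\<^sup>*" "s \<in> perms n" "t \<in> perms n"
    by (auto simp: permutohedron_def)
  then show "s \<in> perms n" "t \<in> perms n" by blast+
  from st(1) show "\<forall>a b. a < b \<longrightarrow> precedes s b a \<longrightarrow> precedes t b a"
  proof (induction rule: rtrancl_induct)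
    case (step y z)
    then obtain u v a b where ab: "a < b" "y = u @ [a, b] @ v" "z = u @ [b, a] @ v"
      unfolding permutohedron_cover_def by blast
    have "precedes z d c" if "c < d" "precedes y d c" for c d
      using that ab by auto
    then show ?case using step.IH by blast
  qed blast
next
  assume *: "s \<in> perms n \<and> t \<in> perms n \<and>
    (\<forall>a b. a < b \<longrightarrow> precedes s b a \<longrightarrow> precedes t b a)"
  then have d: "distinct s" "distinct t" "set s = set t"
    and le: "\<forall>a b. a < b \<longrightarrow> precedes s b a \<longrightarrow> precedes t b a"
    and t: "set t = {..<n}" by (auto simp: perms_iff)
  from d le have "(s, t) \<in> (permutohedron_cover n)\<^sup>*"
  proof (induction rule: swap_toward_induct)
    case (swap u p q v)
    have "\<not> q < p" using swap.prems precedes_asym[OF d(2) swap(3)] by fastforce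
    then have pq: "p < q" using swap(1) by auto
    have "(u @ [p, q] @ v, u @ [q, p] @ v) \<in> permutohedron_cover n"
    proof -
      have "u @ [p, q] @ v \<in> perms n" "u @ [q, p] @ v \<in> perms n"
        using swap(1,2) t by (auto simp: perms_iff)
      then show ?thesis using pq unfolding permutohedron_cover_def by blast
    qed
    moreover have "(u @ [q, p] @ v, t) \<in> (permutohedron_cover n)\<^sup>*"
    proof (rule swap.IH, intro allI impI)
      fix a b assume "a < b" "precedes (u @ [q, p] @ v) b a"
      then show "precedes t b a"
        using swap(3) swap.prems unfolding precedes_swap[OF swap(1)] by blast
    qed
    ultimately show ?case by (rule converse_rtrancl_into_rtrancl)
  qed simp
  then show "(s, t) \<in> permutohedron n" using * by (simp add: permutohedron_def)
qed

section \<open>Extremal elements of a Baxter class\<close>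

lemma adjacent_change:
  "P p \<Longrightarrow> \<not> P q \<Longrightarrow> \<exists>u r s v. p # m @ [q] = u @ [r, s] @ v \<and> P r \<and> \<not> P s"
proof (induction m arbitrary: p)
  case Nil
  then show ?case by (intro exI[of _ "[]"]) auto
next
  case (Cons a m)
  show ?case
  proof (cases "P a")
    case True
    then obtain u r s v where "a # m @ [q] = u @ [r, s] @ v \<and> P r \<and> \<not> P s"
      using Cons by blast
    then show ?thesis by (intro exI[of _ "p # u"]) auto
  next
    case False
    then show ?thesis using Cons.prems by (intro exI[of _ "[]"]) auto
  qed
qed

text \<open>Taking \<open>lt\<close> to be \<open>(<)\<close> or \<open>(>)\<close> covers the least and the greatest element at once.\<close>

lemma descents_forced_imp:
  fixes w :: "'a::linorder list"
  assumes lt: "lt = (<) \<or> lt = (>)" and d: "distinct w"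
    and adj: "\<And>u p q v. w = u @ [p, q] @ v \<Longrightarrow> lt q p \<Longrightarrow> forced w p q"
    and t: "distinct t" "\<And>p q. forced w p q \<Longrightarrow> precedes t p q"
    and pq: "lt q p" "precedes w p q"
  shows "precedes t p q"
proof -
  \<comment> \<open>Below, the choice of \<open>lt\<close> enters only through these four facts,
    valid for \<open>(<)\<close> and \<open>(>)\<close> alike.\<close>
  have tr: "lt x y \<Longrightarrow> lt y z \<Longrightarrow> lt x z" for x y z using lt by auto
  have tot: "lt x y \<or> x = y \<or> lt y x" for x y using lt by auto
  have bt: "between x y z \<longleftrightarrow> lt x y \<and> lt y z \<or> lt z y \<and> lt y x" for x y z
    using lt by (auto simp: between_def)
  have irr: "\<not> lt x x" for x using lt by auto
  obtain u m v where "w = u @ [p] @ m @ [q] @ v" using precedes_split[OF pq(2)] by blast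
  then show ?thesis using pq(1)
  proof (induction "length m" arbitrary: u p m q v rule: less_induct)
    case less
    show ?case
    proof (cases "\<exists>r\<in>set m. lt q r \<and> lt r p")
      \<comment> \<open>A letter of intermediate value splits the pair into two closer ones,
        rejoined in \<open>t\<close> by transitivity.\<close>
      case True
      then obtain r m1 m2 where r: "lt q r" "lt r p" and m: "m = m1 @ [r] @ m2"
        by (metis append_Cons append_Nil split_list)
      have "precedes t p r"
        by (rule less.hyps[of m1 u p r "m2 @ [q] @ v"]) (use less.prems m r in auto)
      moreover have "precedes t r q"
        by (rule less.hyps[of m2 "u @ [p] @ m1" r q v]) (use less.prems m r in auto)
      ultimately show ?thesis using precedes_trans t by metis
    next
      case False
      \<comment> \<open>Scanning from \<open>p\<close> to \<open>q\<close>, some adjacent step drops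
        below \<open>p\<close> with respect to \<open>lt\<close>. As no letter of \<open>m\<close>
        lies between \<open>q\<close> and \<open>p\<close> in value, this drop reaches
        \<open>q\<close> or goes further, so the values of \<open>r\<close> and \<open>s\<close>
        enclose those of \<open>p\<close> and \<open>q\<close>.\<close>
      obtain u' r s v' where rs: "p # m @ [q] = u' @ [r, s] @ v'" "\<not> lt r p" "lt s p"
        using adjacent_change[of "\<lambda>r. \<not> lt r p" p q m] irr less.prems by blast
      have w: "w = (u @ u') @ [r, s] @ (v' @ v)"
        using less.prems(1) arg_cong[OF rs(1), of "\<lambda>l. u @ l @ v"] by simp
      have rp: "r = p \<or> lt p r" using rs tot by blast
      have "s \<in> set (p # m @ [q])" unfolding rs(1) by simp
      then have sq: "s = q \<or> lt s q" using False rs(3) irr tot by auto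
      have "lt s r" using rp rs(3) tr by blast
      then have f: "forced w r s" using adj w by blast
      have pr: "r = p \<or> precedes w p r"
      proof (cases u')
        case Nil
        then show ?thesis using rs by simp
      next
        case (Cons a l)
        then show ?thesis using rs w by simp
      qed
      have sq': "s = q \<or> precedes w s q"
      proof (cases v' rule: rev_cases)
        case Nil
        then have "p # m @ [q] = (u' @ [r]) @ [s]" using rs by simp
        then have "last (p # m @ [q]) = last ((u' @ [r]) @ [s])" by (rule arg_cong)
        then show ?thesis by simp
      next
        case (snoc l a)
        then have "p # m @ [q] = (u' @ [r, s] @ l) @ [a]" using rs by simp
        then have "last (p # m @ [q]) = last ((u' @ [r, s] @ l) @ [a])" by (rule arg_cong)
        then show ?thesis using w snoc by simp
      qed
      have pqw: "precedes w p q" using less.prems by simp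
      \<comment> \<open>If the left alternative holds for \<open>(r, s)\<close>, then
        \<open>p\<close> would violate it unless \<open>r = p\<close>; if the right one holds,
        \<open>q\<close> would violate it unless \<open>s = q\<close>. The alternative then passes
        to the narrower range of values of \<open>(p, q)\<close>.\<close>
      have "forced w p q"
      proof (cases "\<forall>x. between r x s \<longrightarrow> \<not> precedes w x r")
        case True
        have "r = p"
        proof (rule ccontr)
          assume "r \<noteq> p"
          then have "between r p s" using bt rp rs by blast
          then show False using True pr \<open>r \<noteq> p\<close> by blast
        qed
        moreover have "between r x s" if "between p x q" for x
          using that sq \<open>r = p\<close> bt tr irr less.prems(2) by metis
        ultimately show ?thesis using True pqw unfolding forced_def by blast
      next
        case False
        then have R: "\<forall>y. between r y s \<longrightarrow> \<not> precedes w s y" using f unfolding forced_def by blast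
        have "s = q"
        proof (rule ccontr)
          assume "s \<noteq> q"
          then have "between r q s" using bt rp sq tr less.prems(2) by metis
          then show False using R sq' \<open>s \<noteq> q\<close> by blast
        qed
        moreover have "between r x s" if "between p x q" for x
          using that rp \<open>s = q\<close> bt tr irr less.prems(2) by metis
        ultimately show ?thesis using R pqw unfolding forced_def by blast
      qed
      then show ?thesis using t by blast
    qed
  qed
qed

text \<open>In a member minimizing the size of \<open>?I\<close>, exchanging an unforced adjacent
  pair of \<open>?I\<close> would stay in the class and lower the count, so
  \<open>descents_forced_imp\<close> applies. For \<open>(<)\<close> the set \<open>?I\<close>
  consists of the inversions, for \<open>(>)\<close> of the non-inversions.\<close>

lemma baxter_class_extremum:
  assumes lt: "lt = (<) \<or> lt = (>)" and s: "distinct s"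
  shows "\<exists>w. s \<equiv>\<^sub>B w \<and> (\<forall>t p q. s \<equiv>\<^sub>B t \<longrightarrow> lt q p \<longrightarrow> precedes w p q \<longrightarrow> precedes t p q)"
proof -
  let ?I = "\<lambda>w. {(p, q). lt q p \<and> precedes w p q}"
  obtain w where sw: "s \<equiv>\<^sub>B w" and least: "\<And>t. s \<equiv>\<^sub>B t \<Longrightarrow> card (?I w) \<le> card (?I t)"
    using ex_has_least_nat[of "\<lambda>w. s \<equiv>\<^sub>B w" s "\<lambda>w. card (?I w)"] baxter_cong.refl by blast
  have d: "distinct w" using sw s baxter_cong_distinct by blast
  have adj: "forced w p q" if w: "w = u @ [p, q] @ v" and "lt q p" for u p q v
  proof (rule ccontr)
    let ?w = "u @ [q, p] @ v"
    assume "\<not> forced w p q"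
    then have "w \<equiv>\<^sub>B ?w" using baxter_cong_swap_not_forced d w by blast
    then have "card (?I w) \<le> card (?I ?w)" using least sw baxter_cong.trans by blast
    moreover have "card (?I ?w) < card (?I w)"
    proof (rule psubset_card_mono)
      show "finite (?I w)"
        by (rule finite_subset[of _ "set w \<times> set w"]) (auto dest: precedes_set)
      have sub: "\<not> lt p q" using \<open>lt q p\<close> lt by auto
      have "(p, q) \<in> ?I w - ?I ?w"
        using \<open>lt q p\<close> w d precedes_irrefl[OF d] precedes_swap[of u p q v] by fastforce
      moreover have "?I ?w \<subseteq> ?I w"
        using sub w d precedes_swap[of u p q v] by (auto simp del: precedes_append)
      ultimately show "?I ?w \<subset> ?I w" by blast
    qed
    ultimately show False by simp
  qed
  have "precedes t p q" if t: "s \<equiv>\<^sub>B t" and pq: "lt q p" "precedes w p q" for t p q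
  proof (rule descents_forced_imp[OF lt d adj _ _ pq])
    show "distinct t" using t s baxter_cong_distinct by blast
    have "w \<equiv>\<^sub>B t" using t sw baxter_cong.sym baxter_cong.trans by blast
    then show "precedes t a b" if "forced w a b" for a b
      using that baxter_cong_forced d forced_precedes by metis
  qed
  then show ?thesis using sw by blast
qed

theorem proposition3p8:
  fixes n :: nat
  shows "\<forall>C \<in> perms n // baxter_on_perms n. poset_interval (perms n) (permutohedron n) C"
proof
  fix C assume "C \<in> perms n // baxter_on_perms n"
  then obtain s where s: "s \<in> perms n" and "C = baxter_on_perms n `` {s}"
    by (rule quotientE)
  then have C: "C = {t \<in> perms n. s \<equiv>\<^sub>B t}" by (auto simp: baxter_on_perms_def)
  have ds: "distinct s" using s perms_iff by blast
  obtain x where x: "s \<equiv>\<^sub>B x"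
    and xle: "\<And>t a b. s \<equiv>\<^sub>B t \<Longrightarrow> a < b \<Longrightarrow> precedes x b a \<Longrightarrow> precedes t b a"
    using baxter_class_extremum[OF disjI1[OF HOL.refl] ds] by blast
  obtain y where y: "s \<equiv>\<^sub>B y"
    and yge: "\<And>t a b. s \<equiv>\<^sub>B t \<Longrightarrow> a < b \<Longrightarrow> precedes y a b \<Longrightarrow> precedes t a b"
    using baxter_class_extremum[OF disjI2[OF HOL.refl] ds] by blast
  have P: "t \<in> perms n" if "s \<equiv>\<^sub>B t" for t
    using s baxter_cong_distinct[OF that] baxter_cong_set[OF that] by (simp add: perms_iff)
  have rev: "precedes v b a \<longleftrightarrow> \<not> precedes v a b"
    if "v \<in> perms n" "a < n" "b < n" "a \<noteq> b" for v a b
    using that precedes_total[of a v b] precedes_asym[of v a b] by (auto simp: perms_iff)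
  have bound: "a < n \<and> b < n" if "v \<in> perms n" "precedes v a b" for v a b
    using precedes_set[OF that(2)] that(1) by (simp add: perms_iff)
  \<comment> \<open>The class shares the non-inversions of \<open>y\<close>; by complement, every
    inversion of a member is one of \<open>y\<close>.\<close>
  have upper: "(t, y) \<in> permutohedron n" if t: "s \<equiv>\<^sub>B t" for t
    unfolding permutohedron_iff
  proof (intro conjI allI impI)
    fix a b :: nat
    assume ab: "a < b" "precedes t b a"
    then have "a < n" "b < n" using bound P[OF t] by blast+
    then show "precedes y b a"
      using ab rev[OF P[OF t], of a b] rev[OF P[OF y], of a b] yge[OF t] by auto
  qed (use P t y in auto)
  have lower: "(x, t) \<in> permutohedron n" if "s \<equiv>\<^sub>B t" for t
    using that P x xle by (auto simp: permutohedron_iff)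
  have convex: "s \<equiv>\<^sub>B z"
    if xz: "(x, z) \<in> permutohedron n" and zy: "(z, y) \<in> permutohedron n" for z
  proof -
    have z: "z \<in> perms n" using xz permutohedron_iff by blast
    \<comment> \<open>A forced pair of \<open>s\<close> has the same order in \<open>x\<close> and
      \<open>y\<close>. If it is an inversion, it persists going up from \<open>x\<close>; otherwise
      it persists going down from \<open>y\<close>.\<close>
    have "precedes z p q" if "forced s p q" for p q
    proof -
      have pq: "precedes x p q" "precedes y p q"
        using that x y baxter_cong_forced[OF _ ds] forced_precedes by metis+
      have b: "p < n" "q < n" using bound[OF P[OF x] pq(1)] by blast+
      have "p \<noteq> q"
        using pq(1) precedes_irrefl[of x p] P[OF x] by (auto simp: perms_iff)
      show ?thesis
      proof (cases "q < p")
        case True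
        then show ?thesis using xz pq by (auto simp: permutohedron_iff)
      next
        case False
        then have "p < q" using \<open>p \<noteq> q\<close> by simp
        then show ?thesis
          using zy pq rev[OF z, of p q] rev[OF P[OF y], of p q] b by (auto simp: permutohedron_iff)
      qed
    qed
    then show ?thesis using baxter_cong_iff_forced[of s z] s z by (auto simp: perms_iff)
  qed
  have "C = {z \<in> perms n. (x, z) \<in> permutohedron n \<and> (z, y) \<in> permutohedron n}"
    unfolding C using upper lower convex by blast
  then show "poset_interval (perms n) (permutohedron n) C"
    unfolding poset_interval_def using P x y lower by blast
qed

end
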